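(* For every integer $n\ge 1$, the average number of fixed points over all restricted growth sequences of length $n$ is $$E(\mathcal F_n)=\frac{1}{B_n}\left.\frac{d^n}{dx^n}T(x)\right|_{x=0}=\frac{1}{B_n}\sum_{i=1}^n\left(\sum_{j=1}^i\sum_{\ell=j}^i\frac{(-1)^{\ell-i}\,\ell^{\,n-j}}{(\ell-j)!\,(i-\ell)!}\right),$$ where $T(x)=\left.\frac{\partial}{\partial q}R(x,1;q)\right|_{q=1}$ is the exponential generating function for the total number of fixed points over all restricted growth sequences of length $n$.
   Context: A restricted growth sequence of length $n\ge 1$ is a sequence $\pi=\pi_1\pi_2\cdots\pi_n$ of positive integers with $\pi_1=1$ and $\pi_{j+1}\le 1+\max\{\pi_1,\dots,\pi_j\}$ for all $1\le j<n$. The set of all of them is denoted $\mathcal R_n$, and $\mathcal R_{n,k}$ is the subset of those with maximal letter $k$. The null sequence is the unique sequence of length $0$, counted with maximal letter $0$ and no fixed points. The cardinality of $\mathcal R_n$ is the $n$-th Bell number $B_n$ (with $B_0=1$). An index $i\in\{1,\dots,n\}$ is a fixed point of $\pi$ if $\pi_i=i$, and $\mathcal F_\pi$ denotes the number of fixed points of $\pi$. The random variable $\mathcal F_n$ is $\mathcal F_{\pi}$ for $\pi$ chosen uniformly at random from $\mathcal R_n$, and $E$ denotes expectation, so $E(\mathcal F_n)=\frac1{B_n}\sum_{\pi\in\mathcal R_n}\mathcal F_\pi$. The generating function $R$ is $$R(x,y;q)=\sum_{n\ge 0}\left(\sum_{k\ge 0}\sum_{\pi\in\mathcal R_{n,k}}q^{\mathcal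 F_\pi}y^k\right)\frac{x^n}{n!}$$ (the $n=0$ term being $1$), so that $T(x)=\sum_{n\ge 1}\left(\sum_{\pi\in\mathcal R_n}\mathcal F_\pi\right)\frac{x^n}{n!}$, viewed as a formal power series in $x$. *)

theory Defs
  imports
    "HOL-Probability.Probability"
    "HOL-Computational_Algebra.Formal_Power_Series"
    "HOL-Library.Disjoint_Sets"
begin

text \<open>
  Sequences are lists indexed from 0, so the \<open>i\<close>-th letter (\<open>i \<ge> 1\<close>) of \<open>\<pi>\<close> is \<open>\<pi> ! (i - 1)\<close>.
  The null sequence counts as a restricted growth sequence of length 0.
\<close>

definition is_rgs :: "nat list \<Rightarrow> bool" where
  "is_rgs \<pi> \<longleftrightarrow>
     (\<forall>a\<in>set \<pi>. 1 \<le> a) \<and>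
     (\<pi> \<noteq> [] \<longrightarrow> \<pi> ! 0 = 1) \<and>
     (\<forall>j. 1 \<le> j \<and> j < length \<pi> \<longrightarrow> \<pi> ! j \<le> 1 + Max (set (take j \<pi>)))"

definition RGS :: "nat \<Rightarrow> nat list set" where
  "RGS n = {\<pi>. length \<pi> = n \<and> is_rgs \<pi>}"

definition max_letter :: "nat list \<Rightarrow> nat" where
  "max_letter \<pi> = (if \<pi> = [] then 0 else Max (set \<pi>))"

definition RGS_max :: "nat \<Rightarrow> nat \<Rightarrow> nat list set" where
  "RGS_max n k = {\<pi> \<in> RGS n. max_letter \<pi> = k}"

definition fixed_points :: "nat list \<Rightarrow> nat" where
  "fixed_points \<pi> = card {i \<in> {1..length \<pi>}. \<pi> ! (i - 1) = i}"

definition bell :: "nat \<Rightarrow> nat" where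
  "bell n = card {P. partition_on {1..n} P}"

definition expected_fixed_points :: "nat \<Rightarrow> real" where
  "expected_fixed_points n =
     measure_pmf.expectation (pmf_of_set (RGS n)) (\<lambda>\<pi>. real (fixed_points \<pi>))"

text \<open>
  For fixed \<open>y\<close> and \<open>q\<close>, \<open>rgs_gf y q\<close> is the formal power series in \<open>x\<close>.  Its coefficients are
  polynomial functions of \<open>y\<close> and \<open>q\<close>: the sum over \<open>k\<close> has only finitely many nonzero terms.
\<close>

definition rgs_gf :: "real \<Rightarrow> real \<Rightarrow> real fps" where
  "rgs_gf y q =
     Abs_fps (\<lambda>n. (\<Sum>k. \<Sum>\<pi>\<in>RGS_max n k. q ^ fixed_points \<pi> * y ^ k) / fact n)"

text \<open>The derivative with respect to \<open>q\<close>, at \<open>y = q = 1\<close>, taken coefficientwise in \<open>x\<close>.\<close>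

definition fixed_points_gf :: "real fps" where
  "fixed_points_gf = Abs_fps (\<lambda>n. deriv (\<lambda>q. fps_nth (rgs_gf 1 q) n) 1)"

end

theory Submission
  imports Defs
begin

text \<open>
  The letters of a restricted growth sequence climb by at most one above the running maximum, so
  the \<open>j\<close>-th letter is at most \<open>j\<close>, and it equals \<open>j\<close> only if the sequence begins with
  \<open>1, 2, \<dots>, j\<close>.  What follows such a prefix is an arbitrary word of length \<open>n - j\<close> that continues
  a sequence of maximum \<open>j\<close>.  Counting pairs of a sequence and a fixed point, the total number of
  fixed points is therefore \<open>\<Sum>j=1..n. c j (n - j)\<close>, where \<open>c k m\<close> is the number of continuations of
  length \<open>m\<close> of a sequence with maximum \<open>k\<close> (lemma \<open>sum_fixed_points\<close>).

  The first letter of a continuation either is one of the \<open>k\<close> old letters or raises the maximum, so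
  \<open>c k (m + 1) = k * c k m + c (k + 1) m\<close> with \<open>c k 0 = 1\<close>.  Two things follow from this recurrence.

  First, \<open>c k m\<close> has a closed form.  Sorting the continuations by their final maximum \<open>i\<close> gives the
  same recurrence with \<open>c k 0\<close> replaced by the indicator of \<open>i = k\<close>, and the alternating sum over
  \<open>l \<in> {k..i}\<close> in the theorem solves it: at \<open>m = 0\<close> it is a binomial expansion of \<open>(1 - 1) ^ (i - k)\<close>,
  and the step is \<open>l = k + (l - k)\<close> (lemma \<open>card_continuations_eq\<close>).

  Second, there are as many restricted growth sequences as set partitions.  A partition with \<open>k\<close>
  blocks extends to one more element in \<open>k\<close> ways that keep the number of blocks and one way that
  raises it.  Hence the sum of \<open>c (card P) m\<close> over all partitions \<open>P\<close> of \<open>{1..n}\<close> depends on \<open>n + m\<close>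
  only; it is \<open>c 0 N\<close> for \<open>n = 0, m = N\<close> and the Bell number for \<open>n = N, m = 0\<close>
  (lemma \<open>card_RGS\<close>).

  The generating function contributes only its coefficients: at \<open>y = 1\<close> the sum over the maximal
  letter merges into a finite sum over all sequences, a polynomial in \<open>q\<close> whose derivative at
  \<open>q = 1\<close> adds up the exponents.
\<close>

section \<open>Continuing a restricted growth sequence\<close>

text \<open>
  \<open>growth k s\<close> says that \<open>s\<close> may follow a restricted growth sequence with maximum \<open>k\<close>.  Carrying the
  maximum as a parameter turns the condition on prefixes into a recursion along the list, and
  \<open>k = 0\<close> covers the sequences themselves: it forces the first letter to be 1.
\<close>

primrec growth :: "nat \<Rightarrow> nat list \<Rightarrow> bool" where
  "growth k [] \<longleftrightarrow> True"
| "growth k (a # s) \<longleftrightarrow> 1 \<le> a \<and> a \<le> Suc k \<and> growth (max k a) s"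

definition continuations :: "nat \<Rightarrow> nat \<Rightarrow> nat list set" where
  "continuations k m = {s. length s = m \<and> growth k s}"

text \<open>
  Inserting \<open>k\<close> into the set of earlier letters also keeps the maximum well defined at position 0,
  where no letter precedes.
\<close>

lemma growth_iff_nth:
  "growth k s \<longleftrightarrow>
     (\<forall>a\<in>set s. 1 \<le> a) \<and> (\<forall>j<length s. s ! j \<le> 1 + Max (insert k (set (take j s))))"
proof (induction s arbitrary: k)
  case Nil
  then show ?case by simp
next
  case (Cons a s)
  have "Max (insert (max k a) X) = Max (insert k (insert a X))" if "finite X" for X
    using that by (cases "X = {}") (auto simp: max.assoc)
  then show ?case
    by (auto simp: Cons.IH All_less_Suc2)
qed

lemma is_rgs_iff_growth: "is_rgs \<pi> \<longleftrightarrow> growth 0 \<pi>"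
proof -
  have Max0: "Max (insert 0 (set (take j \<pi>))) = Max (set (take j \<pi>))" if "1 \<le> j" "j < length \<pi>" for j
    using that by (subst Max_insert) auto
  have "(\<forall>j<length \<pi>. \<pi> ! j \<le> 1 + Max (insert 0 (set (take j \<pi>)))) \<longleftrightarrow>
      (\<pi> \<noteq> [] \<longrightarrow> \<pi> ! 0 \<le> 1) \<and>
      (\<forall>j. 1 \<le> j \<and> j < length \<pi> \<longrightarrow> \<pi> ! j \<le> 1 + Max (set (take j \<pi>)))" (is "?L \<longleftrightarrow> ?R")
  proof
    assume L: ?L
    show ?R
      using L[rule_format, of 0] L Max0 by (auto simp: Suc_le_eq)
  next
    assume R: ?R
    show ?L
    proof (intro allI impI)
      fix j assume "j < length \<pi>"
      then show "\<pi> ! j \<le> 1 + Max (insert 0 (set (take j \<pi>)))"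
        using R Max0[of j] by (cases "j = 0") auto
    qed
  qed
  then have "growth 0 \<pi> \<longleftrightarrow> (\<forall>a\<in>set \<pi>. 1 \<le> a) \<and> (\<pi> \<noteq> [] \<longrightarrow> \<pi> ! 0 \<le> 1) \<and>
     (\<forall>j. 1 \<le> j \<and> j < length \<pi> \<longrightarrow> \<pi> ! j \<le> 1 + Max (set (take j \<pi>)))"
    unfolding growth_iff_nth by blast
  also have "\<dots> \<longleftrightarrow> is_rgs \<pi>"
    unfolding is_rgs_def by (auto simp: le_antisym)
  finally show ?thesis ..
qed

lemma RGS_eq_continuations: "RGS n = continuations 0 n"
  by (simp add: RGS_def continuations_def is_rgs_iff_growth)

lemma continuations_0: "continuations k 0 = {[]}"
  by (auto simp: continuations_def)

text \<open>
  The two parts are the two possibilities for the first letter: an old letter leaves the maximum at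
  \<open>k\<close>, and the only admissible new letter is \<open>k + 1\<close>.
\<close>

lemma continuations_Suc:
  "continuations k (Suc m) =
     (\<lambda>(a, s). a # s) ` ({1..k} \<times> continuations k m) \<union> (#) (Suc k) ` continuations (Suc k) m"
proof (intro equalityI subsetI)
  fix s assume "s \<in> continuations k (Suc m)"
  then obtain a t where s: "s = a # t" "length t = m" "1 \<le> a" "a \<le> Suc k" "growth (max k a) t"
    by (cases s) (auto simp: continuations_def)
  show "s \<in> (\<lambda>(a, s). a # s) ` ({1..k} \<times> continuations k m) \<union> (#) (Suc k) ` continuations (Suc k) m"
  proof (cases "a = Suc k")
    case True
    then show ?thesis using s by (auto simp: continuations_def)
  next
    case False
    then have "max k a = k" using s by auto
    then show ?thesis using s False by (auto simp: continuations_def)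
  qed
qed (auto simp: continuations_def max_def)

lemma finite_continuations [simp]: "finite (continuations k m)"
  by (induction m arbitrary: k) (auto simp: continuations_0 continuations_Suc)

lemma finite_RGS [simp]: "finite (RGS n)"
  by (simp add: RGS_eq_continuations)

lemma card_continuations_0: "card (continuations k 0) = 1"
  by (simp add: continuations_0)

lemma card_continuations_Suc:
  "card (continuations k (Suc m)) = k * card (continuations k m) + card (continuations (Suc k) m)"
proof -
  have "card ((\<lambda>(a, s). a # s) ` ({1..k} \<times> continuations k m)) = k * card (continuations k m)"
    by (subst card_image) (auto simp: inj_on_def)
  moreover have "card ((#) (Suc k) ` continuations (Suc k) m) = card (continuations (Suc k) m)"
    by (rule card_image) simp
  ultimately show ?thesis
    unfolding continuations_Suc by (subst card_Un_disjoint) auto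
qed

section \<open>A closed form for the number of continuations\<close>

text \<open>
  The number of continuations of length \<open>m\<close> that take the maximum from \<open>k\<close> to \<open>i\<close>, which is the
  \<open>k\<close>-Stirling number of the second kind with parameters \<open>m + k\<close> and \<open>i\<close>.  For \<open>i \<ge> k\<close> it is the complete homogeneous symmetric
  polynomial of degree \<open>m - (i - k)\<close> in \<open>k, \<dots>, i\<close>, equivalently the divided difference of
  \<open>x \<mapsto> x ^ m\<close> at these points, written out here.
\<close>

definition r_stirling :: "nat \<Rightarrow> nat \<Rightarrow> nat \<Rightarrow> real" where
  "r_stirling m k i =
     (\<Sum>l=k..i. (- 1) ^ (i - l) * real l ^ m / (fact (l - k) * fact (i - l)))"

lemma r_stirling_0: "r_stirling 0 k i = (if i = k then 1 else 0)"
proof (cases "k \<le> i")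
  case True
  define d where "d = i - k"
  have i: "i = k + d" using True by (simp add: d_def)
  have "r_stirling 0 k i = (\<Sum>l=0..d. (- 1) ^ (d - l) / (fact l * fact (d - l)))"
    unfolding r_stirling_def i
    by (rule sum.reindex_bij_witness[of _ "\<lambda>l. k + l" "\<lambda>l. l - k"]) (auto simp: add.commute)
  also have "\<dots> = (\<Sum>l=0..d. (- 1) ^ l / (fact l * fact (d - l)))"
    by (rule sum.reindex_bij_witness[of _ "\<lambda>l. d - l" "\<lambda>l. d - l"]) auto
  also have "\<dots> = (\<Sum>l\<le>d. (- 1) ^ l * real (d choose l)) / fact d"
    by (auto simp: sum_divide_distrib atLeast0AtMost binomial_fact intro!: sum.cong)
  also have "\<dots> = (if i = k then 1 else 0)"
    using choose_alternating_sum[of d, where ?'a = real] by (auto simp: i)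
  finally show ?thesis .
qed (auto simp: r_stirling_def)

text \<open>
  Split one factor \<open>l\<close> of \<open>l ^ (m + 1)\<close> as \<open>k + (l - k)\<close>.  The second part cancels against
  \<open>fact (l - k)\<close>, which deletes the term \<open>l = k\<close> and shifts \<open>k\<close> to \<open>k + 1\<close> in the others.
\<close>

lemma r_stirling_Suc:
  "r_stirling (Suc m) k i = k * r_stirling m k i + r_stirling m (Suc k) i"
proof -
  let ?t = "\<lambda>l. (- 1) ^ (i - l) * real l ^ m / (fact (i - l))"
  have "r_stirling (Suc m) k i =
        (\<Sum>l=k..i. real k * (?t l / fact (l - k)) + real (l - k) / fact (l - k) * ?t l)"
    unfolding r_stirling_def
    by (rule sum.cong) (auto simp: of_nat_diff field_simps)
  also have "\<dots> = k * r_stirling m k i + (\<Sum>l=k..i. real (l - k) / fact (l - k) * ?t l)"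
    by (simp add: r_stirling_def sum.distrib sum_distrib_left mult_ac)
  also have "(\<Sum>l=k..i. real (l - k) / fact (l - k) * ?t l) =
             (\<Sum>l=Suc k..i. real (l - k) / fact (l - k) * ?t l)"
    by (rule sum.mono_neutral_right) auto
  also have "\<dots> = r_stirling m (Suc k) i"
    unfolding r_stirling_def
  proof (rule sum.cong)
    fix l assume "l \<in> {Suc k..i}"
    then have "l - k = Suc (l - Suc k)" by auto
    then show "real (l - k) / fact (l - k) * ?t l =
        (- 1) ^ (i - l) * real l ^ m / (fact (l - Suc k) * fact (i - l))"
      by (simp add: field_simps del: of_nat_Suc)
  qed simp
  finally show ?thesis .
qed

text \<open>
  Each letter raises the maximum by at most one, so the maximum cannot pass \<open>k + m\<close>; equivalently, a
  divided difference of order above \<open>m\<close> annihilates \<open>x \<mapsto> x ^ m\<close>.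
\<close>

lemma r_stirling_eq_0: "i > k + m \<Longrightarrow> r_stirling m k i = 0"
  by (induction m arbitrary: k) (auto simp: r_stirling_0 r_stirling_Suc)

lemma card_continuations_eq:
  "real (card (continuations k m)) = (\<Sum>i=k..k+m. r_stirling m k i)"
proof (induction m arbitrary: k)
  case 0
  then show ?case by (simp add: card_continuations_0 r_stirling_0)
next
  case (Suc m)
  have "(\<Sum>i=k..k + Suc m. r_stirling (Suc m) k i) =
      k * (\<Sum>i=k..k + Suc m. r_stirling m k i) + (\<Sum>i=k..k + Suc m. r_stirling m (Suc k) i)"
    unfolding r_stirling_Suc sum.distrib sum_distrib_left ..
  also have "(\<Sum>i=k..k + Suc m. r_stirling m k i) = (\<Sum>i=k..k+m. r_stirling m k i)"
    by (simp add: r_stirling_eq_0)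
  also have "(\<Sum>i=k..k + Suc m. r_stirling m (Suc k) i) =
      (\<Sum>i=Suc k..Suc k + m. r_stirling m (Suc k) i)"
    by (simp add: sum.atLeast_Suc_atMost[of k] r_stirling_def[of m "Suc k" k])
  finally show ?case
    by (simp add: card_continuations_Suc Suc.IH)
qed

section \<open>Restricted growth sequences are counted by the Bell numbers\<close>

text \<open>
  Removing \<open>a\<close> from a partition of \<open>insert a S\<close> leaves a partition of \<open>S\<close>.  Either \<open>{a}\<close> was a block
  and disappears, or \<open>a\<close> was in a larger block; in that case the partition is recovered from what is
  left together with the choice of the block to which \<open>a\<close> returns.
\<close>

lemma sum_partitions_insert:
  fixes f :: "nat \<Rightarrow> nat"
  assumes S: "finite S" and a: "a \<notin> S"
  shows "(\<Sum>P | partition_on (insert a S) P. f (card P)) =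
         (\<Sum>P | partition_on S P. card P * f (card P) + f (Suc (card P)))"
proof -
  let ?X = "{P. partition_on S P}"
  let ?Y = "{P. partition_on (insert a S) P}"
  have fin: "finite ?X" "finite ?Y"
    using S by (auto intro: finitely_many_partition_on)
  have finP: "finite P" if "P \<in> ?X" for P
    using that S finite_elements by auto
  have notin: "a \<notin> B" if "P \<in> ?X" "B \<in> P" for P B
    using that a by (auto simp: partition_on_def)
  have "(\<Sum>P | P \<in> ?Y \<and> {a} \<in> P. f (card P)) = (\<Sum>P\<in>?X. f (Suc (card P)))"
  proof (rule sum.reindex_bij_witness[of _ "insert {a}" "\<lambda>P. P - {{a}}"])
    fix P assume P: "P \<in> {P. P \<in> ?Y \<and> {a} \<in> P}"
    then have "disjnt B {a}" if "B \<in> P" "B \<noteq> {a}" for B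
      using that P by (intro pairwiseD[of disjnt P]) (auto simp: partition_on_def)
    then have "disjnt {a} (\<Union>(P - {{a}}))"
      by (auto simp: disjnt_iff)
    then have "partition_on (insert a S - {a}) (P - {{a}})"
      using partition_on_insert[of "{a}" "P - {{a}}" "insert a S"] P by (simp add: insert_absorb)
    then show *: "P - {{a}} \<in> ?X" using a by simp
    show "insert {a} (P - {{a}}) = P" using P by auto
    then show "f (Suc (card (P - {{a}}))) = f (card P)"
      using finP[OF *] by (metis Diff_iff card_insert_disjoint singletonI)
  next
    fix P assume P: "P \<in> ?X"
    then have "{a} \<notin> P" using notin by blast
    then show "insert {a} P - {{a}} = P" by auto
    have "disjnt {a} (\<Union>P)" using notin[OF P] by auto
    then show "insert {a} P \<in> {P. P \<in> ?Y \<and> {a} \<in> P}"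
      using partition_on_insert[of "{a}" P "insert a S"] P a by simp
  qed
  moreover have "(\<Sum>P | P \<in> ?Y \<and> {a} \<notin> P. f (card P)) = (\<Sum>P\<in>?X. card P * f (card P))"
  proof -
    \<comment> \<open>Exactly one block contains \<open>a\<close>, so the union is that block, without a choice operator.\<close>
    let ?block = "\<lambda>P. \<Union>{B \<in> P. a \<in> B}"
    have block: "?block P = B" if "disjoint P" "B \<in> P" "a \<in> B" for P B
      using that by (auto simp: pairwise_def disjnt_iff)
    have "(\<Sum>P | P \<in> ?Y \<and> {a} \<notin> P. f (card P)) = (\<Sum>(P, B) \<in> Sigma ?X (\<lambda>P. P). f (card P))"
    proof (rule sum.reindex_bij_witness[of _
          "\<lambda>(P, B). insert (insert a B) (P - {B})"
          "\<lambda>P. (insert (?block P - {a}) (P - {?block P}), ?block P - {a})"])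
      fix P assume P: "P \<in> {P. P \<in> ?Y \<and> {a} \<notin> P}"
      then obtain B where B: "B \<in> P" "a \<in> B" by (auto simp: partition_on_def)
      have dis: "disjoint P" "\<Union>P = insert a S" "{} \<notin> P" "{a} \<notin> P"
        using P by (auto simp: partition_on_def)
      have bl: "?block P = B" using block dis B by blast
      have sep: "C \<inter> B = {}" if "C \<in> P" "C \<noteq> B" for C
        using dis(1) that B by (auto simp: pairwise_def disjnt_def)
      have ne: "B - {a} \<noteq> {}" using dis B by (metis insert_Diff insert_is_Un sup_bot_right)
      \<comment> \<open>The shrunken block is not already present, so the number of blocks does not drop.\<close>
      have new: "B - {a} \<notin> P - {B}"
        using sep[of "B - {a}"] ne by auto
      have "partition_on S (insert (B - {a}) (P - {B}))"
      proof (rule partition_onI)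
        have "\<Union>(P - {B}) = \<Union>P - B" using sep B by blast
        then show "\<Union>(insert (B - {a}) (P - {B})) = S"
          using dis(2) a B by auto
        show "disjnt p q" if "p \<in> insert (B - {a}) (P - {B})" "q \<in> insert (B - {a}) (P - {B})" "p \<noteq> q" for p q
        proof (rule pairwiseD[OF _ that])
          have "disjoint (P - {B})" using dis(1) by (rule pairwise_subset) auto
          then show "disjoint (insert (B - {a}) (P - {B}))"
            using sep by (fastforce simp: pairwise_insert disjnt_def)
        qed
        show "{} \<notin> insert (B - {a}) (P - {B})" using ne dis by auto
      qed
      then show "(insert (?block P - {a}) (P - {?block P}), ?block P - {a}) \<in> Sigma ?X (\<lambda>P. P)"
        unfolding bl by simp
      show "(case (insert (?block P - {a}) (P - {?block P}), ?block P - {a}) of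
              (P, B) \<Rightarrow> insert (insert a B) (P - {B})) = P"
        unfolding bl using B new by (auto simp: insert_absorb)
      have "finite P" using P S finite_elements[of "insert a S" P] by simp
      then have "card (insert (B - {a}) (P - {B})) = card P"
        using new B card.remove[of P B] by (simp add: card_insert_disjoint)
      then show "(case (insert (?block P - {a}) (P - {?block P}), ?block P - {a}) of
              (P, B) \<Rightarrow> f (card P)) = f (card P)"
        unfolding bl by simp
    next
      fix z assume "z \<in> Sigma ?X (\<lambda>P. P)"
      then obtain P B where z: "z = (P, B)" and P: "P \<in> ?X" and B: "B \<in> P" by auto
      have dis: "disjoint P" "\<Union>P = S" "{} \<notin> P"
        using P by (auto simp: partition_on_def)
      have sep: "C \<inter> B = {}" if "C \<in> P" "C \<noteq> B" for C
        using dis(1) that B by (auto simp: pairwise_def disjnt_def)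
      let ?P' = "insert (insert a B) (P - {B})"
      have nP: "insert a B \<notin> P" using notin[OF P] by blast
      have part: "partition_on (insert a S) ?P'"
      proof (rule partition_onI)
        show "\<Union>?P' = insert a S" using dis(2) B by auto
        show "disjnt p q" if "p \<in> ?P'" "q \<in> ?P'" "p \<noteq> q" for p q
        proof (rule pairwiseD[OF _ that])
          have "disjoint (P - {B})" using dis(1) by (rule pairwise_subset) auto
          then show "disjoint ?P'"
            using sep notin[OF P] by (fastforce simp: pairwise_insert disjnt_def)
        qed
        show "{} \<notin> ?P'" using dis by auto
      qed
      obtain b where "b \<in> B" using dis(3) B by (metis ex_in_conv)
      then have "insert a B \<noteq> {a}" using notin[OF P B] by auto
      then have "{a} \<notin> ?P'" using notin[OF P] by auto
      with part show "(case z of (P, B) \<Rightarrow> insert (insert a B) (P - {B})) \<in> {P. P \<in> ?Y \<and> {a} \<notin> P}"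
        by (simp add: z)
      have bl: "?block ?P' = insert a B"
        by (rule block) (use part in \<open>auto simp: partition_on_def\<close>)
      have 1: "insert a B - {a} = B" using notin[OF P B] by auto
      have 2: "?P' - {insert a B} = P - {B}" using nP by auto
      have 3: "insert B (P - {B}) = P" using B by auto
      show "(insert (?block (case z of (P, B) \<Rightarrow> insert (insert a B) (P - {B})) - {a})
              ((case z of (P, B) \<Rightarrow> insert (insert a B) (P - {B})) -
                {?block (case z of (P, B) \<Rightarrow> insert (insert a B) (P - {B}))}),
             ?block (case z of (P, B) \<Rightarrow> insert (insert a B) (P - {B})) - {a}) = z"
        unfolding z prod.case bl 1 2 3 ..
    qed
    also have "\<dots> = (\<Sum>P\<in>?X. \<Sum>B\<in>P. f (card P))"
      using fin finP by (subst sum.Sigma) auto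
    finally show ?thesis by simp
  qed
  moreover have "(\<Sum>P\<in>?Y. f (card P)) =
      (\<Sum>P | P \<in> ?Y \<and> {a} \<in> P. f (card P)) + (\<Sum>P | P \<in> ?Y \<and> {a} \<notin> P. f (card P))"
    by (subst sum.union_disjoint[symmetric]) (use fin in \<open>auto intro!: sum.cong\<close>)
  ultimately show ?thesis
    by (simp add: sum.distrib)
qed

text \<open>
  Moving one unit from \<open>m\<close> to \<open>n\<close> does not change the sum, because inserting an element into a
  partition and prepending a letter to a continuation obey the same rule with the number of blocks
  in the role of the maximum.  Induction on \<open>n\<close> with \<open>m\<close> arbitrary therefore moves everything to the
  side of the continuations.
\<close>

lemma sum_card_continuations_partitions:
  "(\<Sum>P | partition_on {1..n} P. card (continuations (card P) m)) = card (continuations 0 (n + m))"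
proof (induction n arbitrary: m)
  case 0
  have "{P. partition_on {1..0::nat} P} = {{}}" by (auto simp: partition_on_empty)
  then show ?case by simp
next
  case (Suc n)
  have "{1..Suc n} = insert (Suc n) {1..n}" by auto
  then have "(\<Sum>P | partition_on {1..Suc n} P. card (continuations (card P) m)) =
      (\<Sum>P | partition_on {1..n} P. card (continuations (card P) (Suc m)))"
    by (simp add: sum_partitions_insert[of _ _ "\<lambda>k. card (continuations k m)"] card_continuations_Suc)
  then show ?case using Suc.IH[of "Suc m"] by simp
qed

lemma card_RGS: "card (RGS n) = bell n"
  using sum_card_continuations_partitions[where n = n and m = 0]
  by (simp add: card_continuations_0 RGS_eq_continuations bell_def)

section \<open>Counting fixed points\<close>

lemma growth_nth_le: "growth k s \<Longrightarrow> i < length s \<Longrightarrow> s ! i \<le> Suc (k + i)"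
proof (induction s arbitrary: k i)
  case (Cons a s)
  show ?case
  proof (cases i)
    case 0
    then show ?thesis using Cons.prems by simp
  next
    case (Suc i')
    then have "s ! i' \<le> Suc (max k a + i')"
      using Cons.prems by (intro Cons.IH) auto
    also have "\<dots> \<le> Suc (k + i)"
      using Cons.prems Suc by auto
    finally show ?thesis by (simp add: Suc)
  qed
qed simp

text \<open>
  A letter attains the bound of \<open>growth_nth_le\<close> only if every letter up to it is a new maximum: a
  first letter that does not raise the maximum lowers the bound for all later positions by one.  At
  \<open>k = 0\<close> this describes the fixed points, since list position \<open>i\<close> holds the letter of
  index \<open>i + 1\<close>.
\<close>

lemma growth_nth_maximal_iff:
  "growth k s \<and> i < length s \<and> s ! i = Suc (k + i) \<longleftrightarrow>
   (\<exists>t. s = [Suc k..<Suc (Suc (k + i))] @ t \<and> growth (Suc (k + i)) t)"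
proof (induction i arbitrary: k s)
  case 0
  then show ?case by (cases s) auto
next
  case (Suc i)
  show ?case
  proof (cases s)
    case Nil
    then show ?thesis by simp
  next
    case (Cons a u)
    have "growth k s \<and> Suc i < length s \<and> s ! Suc i = Suc (k + Suc i) \<longleftrightarrow>
      a = Suc k \<and> growth (Suc k) u \<and> i < length u \<and> u ! i = Suc (Suc k + i)"
    proof (cases "a = Suc k")
      case False
      have "\<not> (growth k s \<and> Suc i < length s \<and> s ! Suc i = Suc (k + Suc i))"
      proof
        assume *: "growth k s \<and> Suc i < length s \<and> s ! Suc i = Suc (k + Suc i)"
        then have "max k a = k" using False by (auto simp: Cons)
        then show False
          using * growth_nth_le[of k u i] by (simp add: Cons)
      qed
      then show ?thesis using False by blast
    qed (auto simp: Cons)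
    also have "\<dots> \<longleftrightarrow> (\<exists>t. s = [Suc k..<Suc (Suc (k + Suc i))] @ t \<and> growth (Suc (k + Suc i)) t)"
      using Suc.IH[of "Suc k" u] by (auto simp: Cons upt_conv_Cons[of "Suc k"] simp del: upt_Suc)
    finally show ?thesis .
  qed
qed

lemma card_RGS_fixed_point:
  assumes "1 \<le> j" "j \<le> n"
  shows "card {\<pi> \<in> RGS n. \<pi> ! (j - 1) = j} = card (continuations j (n - j))"
proof -
  have "growth 0 \<pi> \<and> j - 1 < length \<pi> \<and> \<pi> ! (j - 1) = j \<longleftrightarrow>
      (\<exists>t. \<pi> = [1..<Suc j] @ t \<and> growth j t)" for \<pi>
    using growth_nth_maximal_iff[of 0 \<pi> "j - 1"] assms by simp
  moreover have "j - 1 < n" using assms by simp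
  ultimately have "{\<pi> \<in> RGS n. \<pi> ! (j - 1) = j} =
      {\<pi>. length \<pi> = n \<and> (\<exists>t. \<pi> = [1..<Suc j] @ t \<and> growth j t)}"
    unfolding RGS_eq_continuations continuations_def by blast
  also have "\<dots> = (@) [1..<Suc j] ` {t. length t = n - j \<and> growth j t}"
  proof (intro equalityI subsetI)
    fix \<pi> assume "\<pi> \<in> {\<pi>. length \<pi> = n \<and> (\<exists>t. \<pi> = [1..<Suc j] @ t \<and> growth j t)}"
    then obtain t where "\<pi> = [1..<Suc j] @ t" "growth j t" "length \<pi> = n" by blast
    then show "\<pi> \<in> (@) [1..<Suc j] ` {t. length t = n - j \<and> growth j t}"
      by (intro image_eqI[of _ _ t]) auto
  qed (use assms in auto)
  finally have "{\<pi> \<in> RGS n. \<pi> ! (j - 1) = j} = (@) [1..<Suc j] ` continuations j (n - j)"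
    by (simp only: continuations_def)
  then show ?thesis
    by (metis card_image inj_onI same_append_eq)
qed

lemma sum_fixed_points:
  "(\<Sum>\<pi>\<in>RGS n. fixed_points \<pi>) = (\<Sum>j=1..n. card (continuations j (n - j)))"
proof -
  have "(\<Sum>\<pi>\<in>RGS n. fixed_points \<pi>) = (\<Sum>\<pi>\<in>RGS n. card {j \<in> {1..n}. \<pi> ! (j - 1) = j})"
    by (rule sum.cong) (auto simp: fixed_points_def RGS_def)
  also have "\<dots> = (\<Sum>j=1..n. card {\<pi> \<in> RGS n. \<pi> ! (j - 1) = j})"
    by (rule sum_multicount_gen) auto
  also have "\<dots> = (\<Sum>j=1..n. card (continuations j (n - j)))"
    by (intro sum.cong refl card_RGS_fixed_point) auto
  finally show ?thesis .
qed

text \<open>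
  The maximum of a continuation of length \<open>n - j\<close> from \<open>j\<close> ends between \<open>j\<close> and \<open>n\<close>; exchanging the two
  summations over \<open>1 \<le> j \<le> i \<le> n\<close> puts the final maximum \<open>i\<close> outside.
\<close>

lemma sum_fixed_points_eq:
  "(\<Sum>\<pi>\<in>RGS n. real (fixed_points \<pi>)) = (\<Sum>i=1..n. \<Sum>j=1..i. r_stirling (n - j) j i)"
proof -
  have "(\<Sum>\<pi>\<in>RGS n. real (fixed_points \<pi>)) = (\<Sum>j=1..n. \<Sum>i=j..n. r_stirling (n - j) j i)"
  proof -
    have "(\<Sum>\<pi>\<in>RGS n. real (fixed_points \<pi>)) = (\<Sum>j=1..n. real (card (continuations j (n - j))))"
      using sum_fixed_points[of n] by (simp flip: of_nat_sum)
    also have "\<dots> = (\<Sum>j=1..n. \<Sum>i=j..n. r_stirling (n - j) j i)"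
      by (rule sum.cong) (simp_all add: card_continuations_eq)
    finally show ?thesis .
  qed
  also have "\<dots> = (\<Sum>i=1..n. \<Sum>j=1..i. r_stirling (n - j) j i)"
    unfolding sum.Sigma[OF finite_atLeastAtMost ballI[OF finite_atLeastAtMost]]
    by (rule sum.reindex_bij_witness[of _ prod.swap prod.swap]) auto
  finally show ?thesis .
qed

section \<open>The generating function\<close>

lemma max_letter_le: "\<pi> \<in> RGS n \<Longrightarrow> max_letter \<pi> \<le> n"
proof -
  assume "\<pi> \<in> RGS n"
  then have *: "growth 0 \<pi>" "length \<pi> = n"
    by (auto simp: RGS_eq_continuations continuations_def)
  have "a \<le> n" if "a \<in> set \<pi>" for a
    using that growth_nth_le[OF *(1)] *(2) by (fastforce simp: in_set_conv_nth)
  then show ?thesis by (simp add: max_letter_def)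
qed

text \<open>
  A maximal letter cannot exceed the length, so the series over \<open>k\<close> is a finite sum, and its terms
  partition the sequences of length \<open>n\<close>.
\<close>

lemma rgs_gf_nth: "fps_nth (rgs_gf 1 q) n = (\<Sum>\<pi>\<in>RGS n. q ^ fixed_points \<pi>) / fact n"
proof -
  have "(\<Sum>k. \<Sum>\<pi>\<in>RGS_max n k. q ^ fixed_points \<pi>) = (\<Sum>k\<le>n. \<Sum>\<pi>\<in>RGS_max n k. q ^ fixed_points \<pi>)"
  proof (rule suminf_finite)
    fix k assume "k \<notin> {..n}"
    then have "RGS_max n k = {}" using max_letter_le by (force simp: RGS_max_def)
    then show "(\<Sum>\<pi>\<in>RGS_max n k. q ^ fixed_points \<pi>) = 0" by simp
  qed simp
  also have "\<dots> = (\<Sum>\<pi>\<in>RGS n. q ^ fixed_points \<pi>)"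
    unfolding RGS_max_def by (rule sum.group) (auto intro: max_letter_le)
  finally show ?thesis by (simp add: rgs_gf_def)
qed

lemma fixed_points_gf_nth:
  "fps_nth fixed_points_gf n = (\<Sum>\<pi>\<in>RGS n. real (fixed_points \<pi>)) / fact n"
proof -
  have "((\<lambda>q::real. fps_nth (rgs_gf 1 q) n) has_field_derivative
         (\<Sum>\<pi>\<in>RGS n. real (fixed_points \<pi>)) / fact n) (at 1)"
    unfolding rgs_gf_nth by (auto intro!: derivative_eq_intros sum.cong)
  then show ?thesis
    by (simp add: fixed_points_gf_def DERIV_imp_deriv)
qed

lemma expected_fixed_points_eq:
  "expected_fixed_points n = (\<Sum>\<pi>\<in>RGS n. real (fixed_points \<pi>)) / real (bell n)"
proof -
  have "card (continuations k m) \<noteq> 0" for k m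
    by (induction m arbitrary: k) (simp_all add: card_continuations_0 card_continuations_Suc)
  then have "RGS n \<noteq> {}"
    by (metis RGS_eq_continuations card.empty)
  then show ?thesis
    by (simp add: expected_fixed_points_def integral_pmf_of_set card_RGS)
qed

theorem corollary3:
  "fixed_points_gf = Abs_fps (\<lambda>n. (\<Sum>\<pi>\<in>RGS n. real (fixed_points \<pi>)) / fact n) \<and>
   (\<forall>n::nat. n \<ge> 1 \<longrightarrow>
      expected_fixed_points n
        = 1 / real (bell n) * fps_nth (fps_nth_deriv n fixed_points_gf) 0 \<and>
      1 / real (bell n) * fps_nth (fps_nth_deriv n fixed_points_gf) 0
        = 1 / real (bell n) *
            (\<Sum>i=1..n. \<Sum>j=1..i. \<Sum>l=j..i.
               (- 1) powi (int l - int i) * real l ^ (n - j) / (fact (l - j) * fact (i - l))))"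
proof (intro conjI allI impI)
  show "fixed_points_gf = Abs_fps (\<lambda>n. (\<Sum>\<pi>\<in>RGS n. real (fixed_points \<pi>)) / fact n)"
    by (rule fps_ext) (simp add: fixed_points_gf_nth)
next
  fix n :: nat
  have deriv: "fps_nth (fps_nth_deriv n fixed_points_gf) 0 = (\<Sum>\<pi>\<in>RGS n. real (fixed_points \<pi>))"
    by (simp add: fps_deriv_maclauren_0 fixed_points_gf_nth)
  then show "expected_fixed_points n
      = 1 / real (bell n) * fps_nth (fps_nth_deriv n fixed_points_gf) 0"
    by (simp add: expected_fixed_points_eq)
  \<comment> \<open>The exponent is never positive, and \<open>- 1\<close> is its own inverse.\<close>
  have sign: "(- 1 :: real) powi (int l - int i) = (- 1) ^ (i - l)" if "l \<le> i" for l i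
  proof -
    have "int l - int i = - int (i - l)" using that by simp
    then show ?thesis
      by (metis power_int_minus power_int_of_nat power_inverse inverse_minus_eq inverse_1)
  qed
  have "(\<Sum>\<pi>\<in>RGS n. real (fixed_points \<pi>)) =
      (\<Sum>i=1..n. \<Sum>j=1..i. \<Sum>l=j..i.
         (- 1) powi (int l - int i) * real l ^ (n - j) / (fact (l - j) * fact (i - l)))"
    unfolding sum_fixed_points_eq r_stirling_def by (intro sum.cong refl) (simp add: sign)
  then show "1 / real (bell n) * fps_nth (fps_nth_deriv n fixed_points_gf) 0
        = 1 / real (bell n) *
            (\<Sum>i=1..n. \<Sum>j=1..i. \<Sum>l=j..i.
               (- 1) powi (int l - int i) * real l ^ (n - j) / (fact (l - j) * fact (i - l)))"
    by (simp only: deriv)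
qed

end
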